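(* Consider the controlled system $$\left\{\begin{aligned}dX_r^{x,u}&=(A_rX_r^{x,u}+B_ru_r)dr+\int_EC_r(\theta)X_r^{x,u}\,\tilde q(dr,d\theta),\quad r\ge0,\\ X_0^{x,u}&=x\in\mathbb{R}^n.\end{aligned}\right.\tag{S}$$ The system (S) is approximately controllable in time $T$ (starting from every $x\in\mathbb{R}^n$ to every target $\xi\in\mathbb{L}^2(\Omega,\mathcal{F}_{[0,T]},\mathbb{P};\mathbb{R}^n)$) if and only if the following two assertions hold simultaneously: (i) the system (S) is approximately terminal controllable to every target $\xi\in\mathbb{L}^2(\Omega,\mathcal{F}_{[0,T]},\mathbb{P};\mathbb{R}^n)$, and (ii) it is also approximately null-controllable in time $T$ (starting from every $x\in\mathbb{R}^n$).
   Context: **Mode process.** Fix $T>0$, an integer $J>1$, and integers $n,d\ge1$. $E$ is a metric space with Borel $\sigma$-field $\mathcal{B}(E)$; $\lambda:E\times\mathbb{R}_+\to\mathbb{R}_+$ is continuous and bounded; $Q:E\times\mathbb{R}_+\to\mathcal{P}(E)$ (probability measures on $E$) satisfies $Q(\gamma,t,\{\gamma\})=0$ for all $(\gamma,t)$, and $\gamma\mapsto Q(\gamma,t,\cdot)$ is weakly continuous uniformly in $t$. Fix $\gamma_0\in E$. On $(\Omega,\mathbb{P})$ the mode process $\Gamma$ has jump times $T_0:=0<T_1<\dots<T_J$ and marks $\gamma_j=\Gamma_{T_j}$: given the past up to the $(j-1)$-th jump ($1\le j\le J$), $\mathbb{P}(T_j-T_{j-1}\ge t)=\exp(-\int_0^t\lambda(\gamma_{j-1},T_{j-1}+r)dr)$,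 and given in addition $T_j$, $\gamma_j$ has law $Q(\gamma_{j-1},T_j,\cdot)$; $\Gamma_t=\gamma_{j}$ on $[T_j,T_{j+1})$; after the $J$-th jump there are no further jumps. $\mathcal{F}_{[0,t]}:=\sigma\{\Gamma_s:s\in[0,t]\}$; $\mathcal{P}$ is the predictable $\sigma$-field. $q(A):=\sum_{j=1}^J\mathbf{1}_{(T_j,\Gamma_{T_j})\in A}$ for $A\in\mathcal{B}(\mathbb{R}_+)\otimes\mathcal{B}(E)$, $\hat q$ is its compensator, equal to $\lambda(\gamma_j,t)Q(\gamma_j,t,d\theta)dt$ on $T_j<t\le T_{j+1}$, $j<J$, and to $0$ after $T_J$; $\tilde q:=q-\hat q$. **Spaces.** For a Euclidean space $\mathcal{E}$: $\mathbb{L}^p(\Omega\times[0,T],\mathcal{P},\mathbb{P}\times\mathcal{L}eb;\mathcal{E})$ is the usual space of predictable processes; $\mathbb{L}^2(\Omega;\mathbb{D}([0,T];\mathcal{E}))$ is the space of progressively measurable càdlàg processes whose supremum norm over $[0,T]$ is square-integrable; $\mathbb{L}^2(\Omega\times[0,T]\times E,q;\mathcal{E})$ is the space of $\mathcal{P}\otimes\mathcal{B}(E)$-measurable $\Phi$ with $\mathbb{E}[\int_{[0,T]\times E}\|\Phi_r(\theta)\|^2q(dr,d\theta)]<\infty$. $\mathcal{U}:=\mathbb{L}^2(\Omega\times[0,T],\mathcal{P},\mathbb{P}\times\mathcal{L}eb;\mathbb{R}^d)$ is the set of admissible controls. **Coefficients (standing assumption).** $A\in\mathbb{L}^\infty(\Omega\times[0,T],\mathcal{P},\mathbb{P}\times\mathcal{L}eb;\mathbb{R}^{n\times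 n})$, $B\in\mathbb{L}^\infty(\Omega\times[0,T],\mathcal{P},\mathbb{P}\times\mathcal{L}eb;\mathbb{R}^{n\times d})$, $C\in\mathbb{L}^2(\Omega\times[0,T]\times E,q;\mathbb{R}^{n\times n})$ with $\mathrm{esssup}_{\omega}\sup_{r\in[0,T],\theta\in E}\|C_r(\omega,\theta)\|<\infty$; and $A_t,B_t,C_t(\cdot)$ vanish on $\{t>T_J\}$. In stochastic integrals against $\tilde q$, càdlàg processes are taken at their left limits. For every $x\in\mathbb{R}^n$, $u\in\mathcal{U}$, (S) has a unique solution $X^{x,u}\in\mathbb{L}^2(\Omega;\mathbb{D}([0,T];\mathbb{R}^n))$ on $[0,T]$. **Controllability notions.** Norms below are those of $\mathbb{L}^2(\Omega,\mathcal{F}_{[0,T]},\mathbb{P};\mathbb{R}^n)$. - (S) is approximately controllable in time $T$ from $x$ to $\xi$ if for every $\varepsilon>0$ there is $u^\varepsilon\in\mathcal{U}$ with $\|X_T^{x,u^\varepsilon}-\xi\|\le\varepsilon$; it is approximately controllable in time $T$ if this holds for every $x\in\mathbb{R}^n$ and every $\xi\in\mathbb{L}^2(\Omega,\mathcal{F}_{[0,T]},\mathbb{P};\mathbb{R}^n)$. - (S) is approximately null-controllable in time $T$ if it is approximately controllable in time $T$ from every $x\in\mathbb{R}^n$ to $\xi=0$. - (S) is approximately terminal controllable to $\xi$ if for every $\varepsilon>0$ there are $x^\varepsilon\in\mathbb{R}^n$ and $u^\varepsilon\in\mathcal{U}$ with $\|X_T^{x^\varepsilon,u^\varepsilon}-\xi\|\le\varepsilon$.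 *)

theory Defs
  imports "HOL-Probability.Probability"
begin

section \<open>The mode process\<close>

locale mode_data = prob_space M
  for M :: "'w measure" +
  fixes J :: nat
    and rate :: "'e::metric_space \<Rightarrow> real \<Rightarrow> real"
    and Q :: "'e \<Rightarrow> real \<Rightarrow> 'e measure"
    and \<tau> :: "nat \<Rightarrow> 'w \<Rightarrow> ereal"
    and \<gamma> :: "nat \<Rightarrow> 'w \<Rightarrow> 'e"
begin

text \<open>\<open>past k m\<close> is generated by the first \<open>k\<close> jump times and the first \<open>m\<close> marks.\<close>

definition past :: "nat \<Rightarrow> nat \<Rightarrow> 'w measure" where
  "past k m = sigma (space M)
     ((\<Union>i\<in>{..k}. {\<tau> i -` S \<inter> space M | S. S \<in> sets borel}) \<union>
      (\<Union>i\<in>{..m}. {\<gamma> i -` S \<inter> space M | S. S \<in> sets borel}))"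

definition mode :: "real \<Rightarrow> 'w \<Rightarrow> 'e" where
  "mode t \<omega> = \<gamma> (Max {j. j \<le> J \<and> \<tau> j \<omega> \<le> ereal t}) \<omega>"

text \<open>Generated by the mode itself, without completion.\<close>

definition filt :: "real \<Rightarrow> 'w measure" where
  "filt t = sigma (space M) (\<Union>s\<in>{0..t}. {mode s -` S \<inter> space M | S. S \<in> sets borel})"

text \<open>The push-forward of counting measure: \<open>q(S)\<close> is the number of \<open>j \<in> {1..J}\<close> with
  \<open>(\<tau>\<^sub>j, \<gamma>\<^sub>j) \<in> S\<close>.\<close>

definition jump_measure :: "'w \<Rightarrow> (real \<times> 'e) measure" where
  "jump_measure \<omega> = distr (count_space {j \<in> {1..J}. \<tau> j \<omega> < \<infinity>}) (borel \<Otimes>\<^sub>M borel)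
     (\<lambda>j. (real_of_ereal (\<tau> j \<omega>), \<gamma> j \<omega>))"

text \<open>The measure \<open>rate (\<gamma>\<^sub>j, r) Q(\<gamma>\<^sub>j, r, d\<theta>) dr\<close> on \<open>\<tau>\<^sub>j < r \<le> \<tau>\<^sub>j\<^sub>+\<^sub>1\<close> for \<open>j < J\<close>, and no mass after \<open>\<tau>\<^sub>J\<close>.
  The set function below is a measure as soon as \<open>r \<mapsto> Q(e, r, S)\<close> is measurable, as for every
  transition kernel; \<open>measure_of\<close> would otherwise return a null measure.\<close>

definition compensator :: "'w \<Rightarrow> (real \<times> 'e) measure" where
  "compensator \<omega> = measure_of UNIV (sets (borel \<Otimes>\<^sub>M borel))
     (\<lambda>S. \<Sum>j<J. \<integral>\<^sup>+r\<in>{r. \<tau> j \<omega> < ereal r \<and> ereal r \<le> \<tau> (Suc j) \<omega>}.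
        ennreal (rate (\<gamma> j \<omega>) r) * emeasure (Q (\<gamma> j \<omega>) r) {\<theta>. (r, \<theta>) \<in> S} \<partial>lborel)"

end

text \<open>
  The hazard \<open>rate\<close> need not integrate to infinity, so a jump time may be infinite; hence the
  extended-real jump times, strictly increasing as long as they are finite, with marks constrained
  only at finite jump times.
\<close>

locale mode_process = mode_data M J rate Q \<tau> \<gamma>
  for M :: "'w measure" and J :: nat
    and rate :: "'e::metric_space \<Rightarrow> real \<Rightarrow> real"
    and Q :: "'e \<Rightarrow> real \<Rightarrow> 'e measure"
    and \<tau> :: "nat \<Rightarrow> 'w \<Rightarrow> ereal" and \<gamma> :: "nat \<Rightarrow> 'w \<Rightarrow> 'e" +
  fixes \<gamma>\<^sub>0 :: 'e
  assumes J_gt_1: "1 < J"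
    and rate_nonneg: "\<And>e t. 0 \<le> t \<Longrightarrow> 0 \<le> rate e t"
    and rate_bounded: "\<exists>K. \<forall>e. \<forall>t\<ge>0. rate e t \<le> K"
    and rate_continuous: "continuous_on (UNIV \<times> {0..}) (\<lambda>(e, t). rate e t)"
    and Q_prob: "\<And>e t. 0 \<le> t \<Longrightarrow> prob_space (Q e t)"
    and Q_sets: "\<And>e t. 0 \<le> t \<Longrightarrow> sets (Q e t) = sets borel"
    and Q_no_self_jump: "\<And>e t. 0 \<le> t \<Longrightarrow> emeasure (Q e t) {e} = 0"
    and Q_weakly_continuous:
      "\<And>(f :: 'e \<Rightarrow> real) e. continuous_on UNIV f \<Longrightarrow> bounded (range f) \<Longrightarrow>
         uniform_limit {0..} (\<lambda>e' t. \<integral>\<theta>. f \<theta> \<partial>Q e' t) (\<lambda>t. \<integral>\<theta>. f \<theta> \<partial>Q e t) (at e)"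
    and \<tau>_measurable: "\<And>j. j \<le> J \<Longrightarrow> \<tau> j \<in> borel_measurable M"
    and \<gamma>_measurable: "\<And>j. j \<le> J \<Longrightarrow> \<gamma> j \<in> borel_measurable M"
    and \<tau>_0: "\<And>\<omega>. \<omega> \<in> space M \<Longrightarrow> \<tau> 0 \<omega> = 0"
    and \<gamma>_0: "\<And>\<omega>. \<omega> \<in> space M \<Longrightarrow> \<gamma> 0 \<omega> = \<gamma>\<^sub>0"
    and \<tau>_increasing:
      "\<And>j \<omega>. j < J \<Longrightarrow> \<omega> \<in> space M \<Longrightarrow> \<tau> j \<omega> < \<tau> (Suc j) \<omega> \<or> \<tau> j \<omega> = \<infinity> \<and> \<tau> (Suc j) \<omega> = \<infinity>"
    and sojourn_law:
      "\<And>j t. j < J \<Longrightarrow> 0 \<le> t \<Longrightarrow>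
         AE \<omega> in M. \<tau> j \<omega> < \<infinity> \<longrightarrow>
           real_cond_exp M (past j j) (indicator {\<omega> \<in> space M. \<tau> j \<omega> + ereal t \<le> \<tau> (Suc j) \<omega>}) \<omega> =
             exp (- (LINT r:{0..t}|lborel. rate (\<gamma> j \<omega>) (real_of_ereal (\<tau> j \<omega>) + r)))"
    and mark_law:
      "\<And>j S. j < J \<Longrightarrow> S \<in> sets borel \<Longrightarrow>
         AE \<omega> in M. \<tau> (Suc j) \<omega> < \<infinity> \<longrightarrow>
           real_cond_exp M (past (Suc j) j) (indicator {\<omega> \<in> space M. \<gamma> (Suc j) \<omega> \<in> S}) \<omega> =
             measure (Q (\<gamma> j \<omega>) (real_of_ereal (\<tau> (Suc j) \<omega>))) S"


section \<open>Processes on a finite horizon\<close>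

definition cadlag_on :: "real \<Rightarrow> (real \<Rightarrow> 'b::topological_space) \<Rightarrow> bool" where
  "cadlag_on T f \<longleftrightarrow>
     (\<forall>t\<in>{0..<T}. (f \<longlongrightarrow> f t) (at_right t)) \<and> (\<forall>t\<in>{0<..T}. \<exists>l. (f \<longlongrightarrow> l) (at_left t))"

context mode_data
begin

definition predictable_sigma :: "real \<Rightarrow> ('w \<times> real) measure" where
  "predictable_sigma T = sigma (space M \<times> {0..T})
     ({S \<times> {0} | S. S \<in> sets (filt 0)} \<union>
      {S \<times> {s<..t} | S s t. 0 \<le> s \<and> s < t \<and> t \<le> T \<and> S \<in> sets (filt s)})"

definition predictable :: "real \<Rightarrow> (real \<Rightarrow> 'w \<Rightarrow> 'b::euclidean_space) \<Rightarrow> bool" where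
  "predictable T Y \<longleftrightarrow> (\<lambda>(\<omega>, t). Y t \<omega>) \<in> borel_measurable (predictable_sigma T)"

definition L2_predictable :: "real \<Rightarrow> (real \<Rightarrow> 'w \<Rightarrow> 'b::euclidean_space) set" where
  "L2_predictable T = {Y. predictable T Y \<and>
     (\<integral>\<^sup>+(\<omega>, t). ennreal ((norm (Y t \<omega>))\<^sup>2) \<partial>(M \<Otimes>\<^sub>M restrict_space lborel {0..T})) < \<infinity>}"

definition Linf_predictable :: "real \<Rightarrow> (real \<Rightarrow> 'w \<Rightarrow> 'b::euclidean_space) set" where
  "Linf_predictable T = {Y. predictable T Y \<and>
     (\<exists>K. AE (\<omega>, t) in M \<Otimes>\<^sub>M restrict_space lborel {0..T}. norm (Y t \<omega>) \<le> K)}"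

definition L2_jump :: "real \<Rightarrow> (real \<Rightarrow> 'w \<Rightarrow> 'e \<Rightarrow> 'b::euclidean_space) set" where
  "L2_jump T = {\<Phi>. (\<lambda>((\<omega>, t), \<theta>). \<Phi> t \<omega> \<theta>) \<in> borel_measurable (predictable_sigma T \<Otimes>\<^sub>M borel) \<and>
     (\<integral>\<^sup>+\<omega>. (\<integral>\<^sup>+p\<in>{0..T} \<times> UNIV. ennreal ((norm (\<Phi> (fst p) \<omega> (snd p)))\<^sup>2) \<partial>jump_measure \<omega>) \<partial>M) < \<infinity>}"

text \<open>Processes are identified when indistinguishable and \<open>filt\<close> is not completed, so the path
  property is only required almost surely.\<close>

definition L2_cadlag :: "real \<Rightarrow> (real \<Rightarrow> 'w \<Rightarrow> 'b::euclidean_space) set" where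
  "L2_cadlag T = {X.
     (\<forall>t\<in>{0..T}. (\<lambda>(\<omega>, s). X s \<omega>) \<in> borel_measurable (filt t \<Otimes>\<^sub>M restrict_space borel {0..t})) \<and>
     (AE \<omega> in M. cadlag_on T (\<lambda>t. X t \<omega>)) \<and>
     (\<integral>\<^sup>+\<omega>. (SUP t\<in>{0..T}. ennreal (norm (X t \<omega>)))\<^sup>2 \<partial>M) < \<infinity>}"

definition L2_terminal :: "real \<Rightarrow> ('w \<Rightarrow> 'b::euclidean_space) set" where
  "L2_terminal T = {\<xi>. \<xi> \<in> borel_measurable (filt T) \<and> (\<integral>\<^sup>+\<omega>. ennreal ((norm (\<xi> \<omega>))\<^sup>2) \<partial>M) < \<infinity>}"

definition L2_norm :: "('w \<Rightarrow> 'b::euclidean_space) \<Rightarrow> real" where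
  "L2_norm \<xi> = sqrt (\<integral>\<omega>. (norm (\<xi> \<omega>))\<^sup>2 \<partial>M)"

definition compensated_integrable :: "'w \<Rightarrow> real \<Rightarrow> (real \<Rightarrow> 'e \<Rightarrow> 'b::euclidean_space) \<Rightarrow> bool" where
  "compensated_integrable \<omega> t \<Phi> \<longleftrightarrow>
     set_integrable (jump_measure \<omega>) ({0<..t} \<times> UNIV) (\<lambda>(r, \<theta>). \<Phi> r \<theta>) \<and>
     set_integrable (compensator \<omega>) ({0<..t} \<times> UNIV) (\<lambda>(r, \<theta>). \<Phi> r \<theta>)"

definition compensated_integral :: "'w \<Rightarrow> real \<Rightarrow> (real \<Rightarrow> 'e \<Rightarrow> 'b::euclidean_space) \<Rightarrow> 'b" where
  "compensated_integral \<omega> t \<Phi> =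
     set_lebesgue_integral (jump_measure \<omega>) ({0<..t} \<times> UNIV) (\<lambda>(r, \<theta>). \<Phi> r \<theta>) -
     set_lebesgue_integral (compensator \<omega>) ({0<..t} \<times> UNIV) (\<lambda>(r, \<theta>). \<Phi> r \<theta>)"

end


section \<open>The controlled system\<close>

locale controlled_system = mode_process M J rate Q \<tau> \<gamma> \<gamma>\<^sub>0
  for M :: "'w measure" and J :: nat
    and rate :: "'e::metric_space \<Rightarrow> real \<Rightarrow> real"
    and Q :: "'e \<Rightarrow> real \<Rightarrow> 'e measure"
    and \<tau> :: "nat \<Rightarrow> 'w \<Rightarrow> ereal" and \<gamma> :: "nat \<Rightarrow> 'w \<Rightarrow> 'e" and \<gamma>\<^sub>0 :: 'e +
  fixes T :: real
    and A :: "real \<Rightarrow> 'w \<Rightarrow> real ^ 'n ^ 'n"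
    and B :: "real \<Rightarrow> 'w \<Rightarrow> real ^ 'd ^ 'n"
    and C :: "real \<Rightarrow> 'w \<Rightarrow> 'e \<Rightarrow> real ^ 'n ^ 'n"
  assumes T_pos: "0 < T"
    and A_Linf: "A \<in> Linf_predictable T"
    and B_Linf: "B \<in> Linf_predictable T"
    and C_L2: "C \<in> L2_jump T"
    and C_bounded: "\<exists>K. AE \<omega> in M. \<forall>r\<in>{0..T}. \<forall>\<theta>. norm (C r \<omega> \<theta>) \<le> K"
    and A_vanishes: "\<And>\<omega> t. \<omega> \<in> space M \<Longrightarrow> t \<in> {0..T} \<Longrightarrow> \<tau> J \<omega> < ereal t \<Longrightarrow> A t \<omega> = 0"
    and B_vanishes: "\<And>\<omega> t. \<omega> \<in> space M \<Longrightarrow> t \<in> {0..T} \<Longrightarrow> \<tau> J \<omega> < ereal t \<Longrightarrow> B t \<omega> = 0"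
    and C_vanishes: "\<And>\<omega> t \<theta>. \<omega> \<in> space M \<Longrightarrow> t \<in> {0..T} \<Longrightarrow> \<tau> J \<omega> < ereal t \<Longrightarrow> C t \<omega> \<theta> = 0"
begin

definition admissible :: "(real \<Rightarrow> 'w \<Rightarrow> real ^ 'd) set" where
  "admissible = L2_predictable T"

definition solution :: "real ^ 'n \<Rightarrow> (real \<Rightarrow> 'w \<Rightarrow> real ^ 'd) \<Rightarrow> (real \<Rightarrow> 'w \<Rightarrow> real ^ 'n) \<Rightarrow> bool" where
  "solution x u X \<longleftrightarrow> X \<in> L2_cadlag T \<and>
     (AE \<omega> in M.
        set_integrable lborel {0..T} (\<lambda>r. A r \<omega> *v X r \<omega> + B r \<omega> *v u r \<omega>) \<and>
        compensated_integrable \<omega> T (\<lambda>r \<theta>. C r \<omega> \<theta> *v Lim (at_left r) (\<lambda>s. X s \<omega>)) \<and>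
        (\<forall>t\<in>{0..T}. X t \<omega> =
           x + (LINT r:{0..t}|lborel. A r \<omega> *v X r \<omega> + B r \<omega> *v u r \<omega>)
             + compensated_integral \<omega> t (\<lambda>r \<theta>. C r \<omega> \<theta> *v Lim (at_left r) (\<lambda>s. X s \<omega>))))"

text \<open>The trajectory from \<open>x\<close> under \<open>u\<close> is unique only up to indistinguishability, so the definitions
  below refer to any version \<open>X\<close> with \<open>solution x u X\<close>; \<open>L2_norm\<close> does not see the choice.\<close>

definition approx_controllable_from_to :: "real ^ 'n \<Rightarrow> ('w \<Rightarrow> real ^ 'n) \<Rightarrow> bool" where
  "approx_controllable_from_to x \<xi> \<longleftrightarrow>
     (\<forall>\<epsilon>>0. \<exists>u\<in>admissible. \<exists>X. solution x u X \<and> L2_norm (\<lambda>\<omega>. X T \<omega> - \<xi> \<omega>) \<le> \<epsilon>)"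

definition approx_controllable :: bool where
  "approx_controllable \<longleftrightarrow> (\<forall>x. \<forall>\<xi>\<in>L2_terminal T. approx_controllable_from_to x \<xi>)"

definition approx_null_controllable :: bool where
  "approx_null_controllable \<longleftrightarrow> (\<forall>x. approx_controllable_from_to x (\<lambda>_. 0))"

definition approx_terminal_controllable_to :: "('w \<Rightarrow> real ^ 'n) \<Rightarrow> bool" where
  "approx_terminal_controllable_to \<xi> \<longleftrightarrow>
     (\<forall>\<epsilon>>0. \<exists>x. \<exists>u\<in>admissible. \<exists>X. solution x u X \<and> L2_norm (\<lambda>\<omega>. X T \<omega> - \<xi> \<omega>) \<le> \<epsilon>)"

end

end

theory Submission
  imports Defs
begin

text \<open>
  Only the linearity of the system in initial state, control and trajectory matters. Given \<open>x\<close> and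
  \<open>\<xi>\<close>, terminal controllability provides a state \<open>y\<close> and a control steering \<open>y\<close> close to \<open>\<xi>\<close>; null
  controllability provides a control steering \<open>x - y\<close> close to \<open>0\<close>; the sum of the two controls
  steers \<open>x\<close> close to \<open>\<xi>\<close>. In the converse direction one may start from any state.
\<close>

section \<open>Elementary bounds for squares of sums\<close>

lemma norm_add_power2_le:
  fixes a b :: "'b::real_normed_vector"
  shows "(norm (a + b))\<^sup>2 \<le> 2 * (norm a)\<^sup>2 + 2 * (norm b)\<^sup>2"
proof -
  have "(norm (a + b))\<^sup>2 \<le> (norm a + norm b)\<^sup>2"
    by (simp add: norm_triangle_ineq power_mono)
  also have "\<dots> \<le> 2 * (norm a)\<^sup>2 + 2 * (norm b)\<^sup>2"
    \<comment> \<open>The gap between the two sides is the square of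
      \<open>norm a - norm b\<close>.\<close>
    using zero_le_power2[of "norm a - norm b"] by (simp add: power2_eq_square algebra_simps)
  finally show ?thesis .
qed

text \<open>Meant for suprema of norms, which may be infinite. An infinite summand makes the right
  side infinite; finite values reduce to the real inequality.\<close>

lemma ennreal_add_power2_le:
  fixes a b :: ennreal
  shows "(a + b)\<^sup>2 \<le> 2 * a\<^sup>2 + 2 * b\<^sup>2"
proof (cases "a = top \<or> b = top")
  case True
  then show ?thesis by (auto simp: power2_eq_square ennreal_mult_top ennreal_top_mult)
next
  case False
  then obtain r s where "a = ennreal r" "b = ennreal s" "0 \<le> r" "0 \<le> s"
    by (metis ennreal_cases)
  moreover have "ennreal ((r + s)\<^sup>2) \<le> ennreal (2 * r\<^sup>2 + 2 * s\<^sup>2)"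
    using zero_le_power2[of "r - s"] by (intro ennreal_leI) (simp add: power2_eq_square algebra_simps)
  moreover have "ennreal (2 * r\<^sup>2 + 2 * s\<^sup>2) = 2 * ennreal (r\<^sup>2) + 2 * ennreal (s\<^sup>2)"
    by (simp add: ennreal_mult)
  ultimately show ?thesis
    by (simp add: ennreal_power flip: ennreal_plus)
qed

lemma nn_integral_norm_add_power2_finite:
  fixes f g :: "'a \<Rightarrow> 'b::euclidean_space"
  assumes [measurable]: "f \<in> borel_measurable N" "g \<in> borel_measurable N"
    and f: "(\<integral>\<^sup>+x. ennreal ((norm (f x))\<^sup>2) \<partial>N) < \<infinity>"
    and g: "(\<integral>\<^sup>+x. ennreal ((norm (g x))\<^sup>2) \<partial>N) < \<infinity>"
  shows "(\<integral>\<^sup>+x. ennreal ((norm (f x + g x))\<^sup>2) \<partial>N) < \<infinity>"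
proof -
  have "(\<integral>\<^sup>+x. ennreal ((norm (f x + g x))\<^sup>2) \<partial>N)
      \<le> (\<integral>\<^sup>+x. 2 * ennreal ((norm (f x))\<^sup>2) + 2 * ennreal ((norm (g x))\<^sup>2) \<partial>N)"
  proof (rule nn_integral_mono)
    fix x
    have "ennreal ((norm (f x + g x))\<^sup>2) \<le> ennreal (2 * (norm (f x))\<^sup>2 + 2 * (norm (g x))\<^sup>2)"
      by (intro ennreal_leI norm_add_power2_le)
    then show "ennreal ((norm (f x + g x))\<^sup>2)
        \<le> 2 * ennreal ((norm (f x))\<^sup>2) + 2 * ennreal ((norm (g x))\<^sup>2)"
      by (simp add: ennreal_mult)
  qed
  also have "\<dots> = 2 * (\<integral>\<^sup>+x. ennreal ((norm (f x))\<^sup>2) \<partial>N) + 2 * (\<integral>\<^sup>+x. ennreal ((norm (g x))\<^sup>2) \<partial>N)"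
    by (simp add: nn_integral_add nn_integral_cmult)
  also have "\<dots> < \<infinity>"
    using f g by (simp add: ennreal_mult_less_top)
  finally show ?thesis .
qed

section \<open>Cadlag paths: left limits and suprema\<close>

lemma cadlag_on_add:
  fixes f g :: "real \<Rightarrow> 'b::topological_monoid_add"
  assumes "cadlag_on T f" "cadlag_on T g"
  shows "cadlag_on T (\<lambda>t. f t + g t)"
  using assms unfolding cadlag_on_def by (fast intro: tendsto_add)

text \<open>\<open>Lim\<close> has an arbitrary value where no limit exists, so additivity rests on
  the existence of both left limits, which the cadlag property gives on (0, T].\<close>

lemma Lim_at_left_add:
  fixes f g :: "real \<Rightarrow> 'b::{t2_space, topological_monoid_add}"
  assumes "cadlag_on T f" "cadlag_on T g" "r \<in> {0<..T}"
  shows "Lim (at_left r) (\<lambda>s. f s + g s) = Lim (at_left r) f + Lim (at_left r) g"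
proof -
  obtain l m where "(f \<longlongrightarrow> l) (at_left r)" "(g \<longlongrightarrow> m) (at_left r)"
    using assms unfolding cadlag_on_def by blast
  moreover from this have "((\<lambda>s. f s + g s) \<longlongrightarrow> l + m) (at_left r)"
    by (rule tendsto_add)
  ultimately show ?thesis
    by (simp add: tendsto_Lim)
qed

text \<open>By right-continuity each value at t < T is a limit of values at rationals in (t, T).
  Nothing is known to the right of T, and T may be irrational, so T is adjoined. The point is that
  the new index set is countable.\<close>

lemma SUP_norm_cadlag:
  fixes f :: "real \<Rightarrow> 'b::real_normed_vector"
  assumes f: "cadlag_on T f" and T: "0 < T"
  shows "(SUP t\<in>{0..T}. ennreal (norm (f t))) = (SUP t\<in>insert T (\<rat> \<inter> {0..T}). ennreal (norm (f t)))"
    (is "?L = ?R")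
proof (rule antisym)
  show "?R \<le> ?L"
    using T by (intro SUP_subset_mono) auto
  show "?L \<le> ?R"
  proof (rule SUP_least)
    fix t assume t: "t \<in> {0..T}"
    show "ennreal (norm (f t)) \<le> ?R"
    proof (cases "t = T")
      case True
      then show ?thesis by (auto intro: SUP_upper)
    next
      case False
      with t have "t \<in> {0..<T}" by auto
      with f have "(f \<longlongrightarrow> f t) (at_right t)" unfolding cadlag_on_def by blast
      then have lim: "((\<lambda>s. ennreal (norm (f s))) \<longlongrightarrow> ennreal (norm (f t))) (at_right t)"
        by (intro tendsto_intros tendsto_ennrealI)
      show ?thesis
      proof (rule ccontr)
        assume "\<not> ennreal (norm (f t)) \<le> ?R"
        \<comment> \<open>Were the value at t above \<open>?R\<close>, all values shortly after t
          would be above it too, among them one at a rational time.\<close>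
        then have "\<forall>\<^sub>F s in at_right t. ?R < ennreal (norm (f s))"
          using order_tendstoD(1)[OF lim] by simp
        then obtain b where b: "t < b" "\<And>s. t < s \<Longrightarrow> s < b \<Longrightarrow> ?R < ennreal (norm (f s))"
          by (auto simp: eventually_at_right_field)
        \<comment> \<open>The bound \<open>min b T\<close> places q both where the strict inequality
          holds and inside the index set.\<close>
        obtain q where q: "q \<in> \<rat>" "t < q" "q < min b T"
          using Rats_dense_in_real[of t "min b T"] b(1) \<open>t \<in> {0..<T}\<close> by auto
        then have "ennreal (norm (f q)) \<le> ?R"
          using t by (intro SUP_upper) auto
        with b(2)[of q] q show False by auto
      qed
    qed
  qed
qed

section \<open>Measurability of the mode, its filtration and predictable processes\<close>

context mode_process
begin

text \<open>The index of the last jump up to t is a measurable integer, and the mode composes the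
  countable family of marks with it. For t nonnegative the index set contains 0, since
  \<open>\<tau> 0\<close> vanishes, so the maximum is a genuine one.\<close>

lemma mode_measurable: "mode t \<in> borel_measurable M" if "0 \<le> t"
proof -
  have "Measurable.pred M (\<lambda>\<omega>. j \<le> J \<and> \<tau> j \<omega> \<le> ereal t)" for j
    using \<tau>_measurable[of j] by (cases "j \<le> J") simp_all
  then have "(\<lambda>\<omega>. Max {j. j \<le> J \<and> \<tau> j \<omega> \<le> ereal t}) \<in> M \<rightarrow>\<^sub>M count_space UNIV"
    by (rule measurable_Max_nat)
  moreover have "Max {j. j \<le> J \<and> \<tau> j \<omega> \<le> ereal t} \<le> J" if "\<omega> \<in> space M" for \<omega>
    using that \<tau>_0 \<open>0 \<le> t\<close> by (intro Max.boundedI) (auto intro!: exI[of _ 0])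
  \<comment> \<open>Marks are known to be measurable only for indices up to J, hence the codomain is
    cut down before composing.\<close>
  ultimately have "(\<lambda>\<omega>. Max {j. j \<le> J \<and> \<tau> j \<omega> \<le> ereal t})
      \<in> M \<rightarrow>\<^sub>M restrict_space (count_space UNIV) {..J}"
    by (intro measurable_restrict_space2) (auto simp only: Pi_iff atMost_iff)
  then have Max: "(\<lambda>\<omega>. Max {j. j \<le> J \<and> \<tau> j \<omega> \<le> ereal t}) \<in> M \<rightarrow>\<^sub>M count_space {..J}"
    by (simp only: restrict_count_space inf_top_right)
  show ?thesis
    unfolding mode_def
    by (rule measurable_compose_countable'[OF _ Max]) (auto intro: \<gamma>_measurable)
qed

lemma space_filt [simp]: "space (filt t) = space M"
  unfolding filt_def by (auto simp: space_measure_of_conv)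

lemma sets_filt_subset: "sets (filt t) \<subseteq> sets M"
  unfolding filt_def
  using mode_measurable by (subst sets_measure_of) (auto intro!: sets.sigma_sets_subset)

lemma space_predictable_sigma: "space (predictable_sigma T) = space M \<times> {0..T}"
  by (simp add: predictable_sigma_def space_measure_of_conv)

lemma borel_measurable_filt: "f \<in> borel_measurable (filt t) \<Longrightarrow> f \<in> borel_measurable M"
  using sets_filt_subset by (auto simp: measurable_def)

text \<open>Every generating rectangle has one side in M and the other Borel in
  \<open>{0..T}\<close>; \<open>0 \<le> T\<close> serves the slice at time 0. This lets predictable
  processes be integrated against the product measure.\<close>

lemma sets_predictable_sigma_subset:
  assumes "0 \<le> T"
  shows "sets (predictable_sigma T) \<subseteq> sets (M \<Otimes>\<^sub>M restrict_space lborel {0..T})"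
proof -
  have times: "S \<times> I \<in> sets (M \<Otimes>\<^sub>M restrict_space lborel {0..T})"
    if "S \<in> sets (filt s)" "I \<in> sets borel" "I \<subseteq> {0..T}" for S I s
    using that sets_filt_subset
    by (intro pair_measureI) (auto simp: sets_restrict_space_iff)
  let ?P = "M \<Otimes>\<^sub>M restrict_space lborel {0..T}"
  let ?G = "{S \<times> {0} | S. S \<in> sets (filt 0)} \<union>
      {S \<times> {s<..t} | S s t. 0 \<le> s \<and> s < t \<and> t \<le> T \<and> S \<in> sets (filt s)}"
  have sp: "space ?P = space M \<times> {0..T}"
    by (simp add: space_pair_measure space_restrict_space)
  have gen: "?G \<subseteq> sets ?P"
    using assms by (auto intro!: times)
  then have "?G \<subseteq> Pow (space M \<times> {0..T})"
    using sets.space_closed[of ?P] unfolding sp by (rule order_trans)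
  then have "sets (predictable_sigma T) = sigma_sets (space M \<times> {0..T}) ?G"
    unfolding predictable_sigma_def by (rule sets_measure_of)
  also have "\<dots> \<subseteq> sets ?P"
    using sets.sigma_sets_subset[OF gen] unfolding sp .
  finally show ?thesis .
qed

lemma predictable_imp_measurable:
  assumes "0 \<le> T" "predictable T Y"
  shows "(\<lambda>(\<omega>, t). Y t \<omega>) \<in> borel_measurable (M \<Otimes>\<^sub>M restrict_space lborel {0..T})"
proof -
  have "space (predictable_sigma T) = space (M \<Otimes>\<^sub>M restrict_space lborel {0..T})"
    by (simp add: space_predictable_sigma space_pair_measure space_restrict_space)
  then show ?thesis
    using assms sets_predictable_sigma_subset unfolding predictable_def measurable_def by auto
qed

section \<open>Spaces of controls and trajectories under addition\<close>

text \<open>Makes the sum of two controls admissible. Predictability is checked in its own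
  sigma-field, while splitting the square integral uses joint measurability in the product
  space.\<close>

lemma L2_predictable_add:
  assumes "0 \<le> T" and Y: "Y \<in> L2_predictable T" and Z: "Z \<in> L2_predictable T"
  shows "(\<lambda>t \<omega>. Y t \<omega> + Z t \<omega>) \<in> L2_predictable T"
proof -
  have "predictable T Y" "predictable T Z"
    using Y Z by (auto simp: L2_predictable_def)
  then have "predictable T (\<lambda>t \<omega>. Y t \<omega> + Z t \<omega>)"
    unfolding predictable_def case_prod_beta' by (rule borel_measurable_add)
  moreover have "(\<integral>\<^sup>+p. ennreal ((norm ((case p of (\<omega>, t) \<Rightarrow> Y t \<omega>) + (case p of (\<omega>, t) \<Rightarrow> Z t \<omega>)))\<^sup>2)
      \<partial>(M \<Otimes>\<^sub>M restrict_space lborel {0..T})) < \<infinity>"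
    using Y Z assms(1)
    by (intro nn_integral_norm_add_power2_finite predictable_imp_measurable)
      (auto simp: L2_predictable_def case_prod_beta')
  ultimately show ?thesis
    by (simp add: L2_predictable_def case_prod_beta')
qed

lemma L2_cadlag_borel_measurable:
  assumes "X \<in> L2_cadlag T" "t \<in> {0..T}"
  shows "X t \<in> borel_measurable M"
proof -
  have "(\<lambda>(\<omega>, s). X s \<omega>) \<in> borel_measurable (filt t \<Otimes>\<^sub>M restrict_space borel {0..t})"
    using assms by (auto simp: L2_cadlag_def)
  \<comment> \<open>Progressive measurability at time t is cut to the section at t by composing with
    this embedding.\<close>
  moreover have "(\<lambda>\<omega>. (\<omega>, t)) \<in> filt t \<rightarrow>\<^sub>M filt t \<Otimes>\<^sub>M restrict_space borel {0..t}"
    using assms(2) by (intro measurable_Pair measurable_ident measurable_const) (auto simp: space_restrict_space)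
  ultimately have "(\<lambda>\<omega>. (\<lambda>(\<omega>, s). X s \<omega>) (\<omega>, t)) \<in> borel_measurable (filt t)"
    by (rule measurable_compose[rotated])
  then show ?thesis
    using borel_measurable_filt by simp
qed

lemma L2_cadlag_square_integrable:
  assumes X: "X \<in> L2_cadlag T" and t: "t \<in> {0..T}"
  shows "(\<integral>\<^sup>+\<omega>. ennreal ((norm (X t \<omega>))\<^sup>2) \<partial>M) < \<infinity>"
proof -
  have "(\<integral>\<^sup>+\<omega>. ennreal ((norm (X t \<omega>))\<^sup>2) \<partial>M) \<le> (\<integral>\<^sup>+\<omega>. (SUP s\<in>{0..T}. ennreal (norm (X s \<omega>)))\<^sup>2 \<partial>M)"
    using t by (intro nn_integral_mono)
      (auto simp: ennreal_power[symmetric] intro!: power_mono SUP_upper)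
  also have "\<dots> < \<infinity>"
    using X by (simp add: L2_cadlag_def)
  finally show ?thesis .
qed

text \<open>The supremum over \<open>{0..T}\<close> is measurable only after passing to a countable index set, which is
  where the path property enters.\<close>

lemma L2_cadlag_add:
  fixes X Y :: "real \<Rightarrow> 'w \<Rightarrow> 'b::euclidean_space"
  assumes T: "0 < T" and X: "X \<in> L2_cadlag T" and Y: "Y \<in> L2_cadlag T"
  shows "(\<lambda>t \<omega>. X t \<omega> + Y t \<omega>) \<in> L2_cadlag T"
proof -
  define I where "I = insert T (\<rat> \<inter> {0..T})"
  have I: "countable I" "I \<subseteq> {0..T}"
    using countable_rat T by (auto simp: I_def)
  define S where "S = (\<lambda>(Z :: real \<Rightarrow> 'w \<Rightarrow> 'b) \<omega>. SUP t\<in>I. ennreal (norm (Z t \<omega>)))"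
  have cad: "AE \<omega> in M. cadlag_on T (\<lambda>t. X t \<omega>)" "AE \<omega> in M. cadlag_on T (\<lambda>t. Y t \<omega>)"
    using X Y by (auto simp: L2_cadlag_def)
  then have cad_add: "AE \<omega> in M. cadlag_on T (\<lambda>t. X t \<omega> + Y t \<omega>)"
    by eventually_elim (rule cadlag_on_add)
  have S_eq: "(\<integral>\<^sup>+\<omega>. (SUP t\<in>{0..T}. ennreal (norm (Z t \<omega>)))\<^sup>2 \<partial>M) = (\<integral>\<^sup>+\<omega>. (S Z \<omega>)\<^sup>2 \<partial>M)"
    if "AE \<omega> in M. cadlag_on T (\<lambda>t. Z t \<omega>)" for Z
    using that T by (intro nn_integral_cong_AE) (auto simp: S_def I_def SUP_norm_cadlag)
  have S_meas: "S Z \<in> borel_measurable M" if "Z \<in> L2_cadlag T" for Z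
  proof -
    have "(\<lambda>\<omega>. ennreal (norm (Z t \<omega>))) \<in> borel_measurable M" if "t \<in> I" for t
    proof -
      have [measurable]: "Z t \<in> borel_measurable M"
        using \<open>Z \<in> L2_cadlag T\<close> that I(2) by (intro L2_cadlag_borel_measurable[of Z T]) auto
      show ?thesis by measurable
    qed
    then show ?thesis
      unfolding S_def using I(1) by (intro borel_measurable_SUP)
  qed
  note [measurable] = S_meas[OF X] S_meas[OF Y]
  have S_fin: "(\<integral>\<^sup>+\<omega>. (S X \<omega>)\<^sup>2 \<partial>M) < \<infinity>" "(\<integral>\<^sup>+\<omega>. (S Y \<omega>)\<^sup>2 \<partial>M) < \<infinity>"
    using X Y cad by (auto simp: S_eq[symmetric] L2_cadlag_def)
  have "(\<integral>\<^sup>+\<omega>. (SUP t\<in>{0..T}. ennreal (norm (X t \<omega> + Y t \<omega>)))\<^sup>2 \<partial>M)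
      = (\<integral>\<^sup>+\<omega>. (S (\<lambda>t \<omega>. X t \<omega> + Y t \<omega>) \<omega>)\<^sup>2 \<partial>M)"
    using cad_add by (rule S_eq)
  also have "\<dots> \<le> (\<integral>\<^sup>+\<omega>. (S X \<omega> + S Y \<omega>)\<^sup>2 \<partial>M)"
  proof (intro nn_integral_mono power_mono)
    fix \<omega>
    show "S (\<lambda>t \<omega>. X t \<omega> + Y t \<omega>) \<omega> \<le> S X \<omega> + S Y \<omega>"
      unfolding S_def
    proof (rule SUP_least)
      fix t assume "t \<in> I"
      have "ennreal (norm (X t \<omega> + Y t \<omega>)) \<le> ennreal (norm (X t \<omega>)) + ennreal (norm (Y t \<omega>))"
        by (simp add: ennreal_plus[symmetric] norm_triangle_ineq ennreal_leI del: ennreal_plus)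
      also have "\<dots> \<le> (SUP t\<in>I. ennreal (norm (X t \<omega>))) + (SUP t\<in>I. ennreal (norm (Y t \<omega>)))"
        using \<open>t \<in> I\<close> by (intro add_mono SUP_upper)
      finally show "ennreal (norm (X t \<omega> + Y t \<omega>))
        \<le> (SUP t\<in>I. ennreal (norm (X t \<omega>))) + (SUP t\<in>I. ennreal (norm (Y t \<omega>)))" .
    qed
  qed simp
  \<comment> \<open>Only finiteness is at stake, so the crude factor 2 replaces Minkowski's
    inequality.\<close>
  also have "\<dots> \<le> (\<integral>\<^sup>+\<omega>. 2 * (S X \<omega>)\<^sup>2 + 2 * (S Y \<omega>)\<^sup>2 \<partial>M)"
    by (intro nn_integral_mono ennreal_add_power2_le)
  also have "\<dots> = 2 * (\<integral>\<^sup>+\<omega>. (S X \<omega>)\<^sup>2 \<partial>M) + 2 * (\<integral>\<^sup>+\<omega>. (S Y \<omega>)\<^sup>2 \<partial>M)"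
    by (simp add: nn_integral_add nn_integral_cmult)
  also have "\<dots> < \<infinity>"
    using S_fin by (simp add: ennreal_mult_less_top)
  finally have "(\<integral>\<^sup>+\<omega>. (SUP t\<in>{0..T}. ennreal (norm (X t \<omega> + Y t \<omega>)))\<^sup>2 \<partial>M) < \<infinity>" .
  moreover have "(\<lambda>(\<omega>, s). X s \<omega> + Y s \<omega>) \<in> borel_measurable (filt t \<Otimes>\<^sub>M restrict_space borel {0..t})"
    if "t \<in> {0..T}" for t
    using X Y that unfolding L2_cadlag_def case_prod_beta' by (auto intro!: borel_measurable_add)
  ultimately show ?thesis
    using cad_add by (simp add: L2_cadlag_def)
qed

section \<open>Linearity and locality of the compensated integral\<close>

lemma compensated_integrable_add:
  assumes "compensated_integrable \<omega> t \<Phi>" "compensated_integrable \<omega> t \<Psi>"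
  shows "compensated_integrable \<omega> t (\<lambda>r \<theta>. \<Phi> r \<theta> + \<Psi> r \<theta>)"
  using assms unfolding compensated_integrable_def case_prod_beta'
  by (intro conjI set_integral_add(1)) (elim conjE, assumption)+

text \<open>The integral is a pathwise difference of two Bochner integrals, and integrability is
  demanded against each measure separately, so linearity of each suffices.\<close>

lemma compensated_integral_add:
  assumes "compensated_integrable \<omega> t \<Phi>" "compensated_integrable \<omega> t \<Psi>"
  shows "compensated_integral \<omega> t (\<lambda>r \<theta>. \<Phi> r \<theta> + \<Psi> r \<theta>)
      = compensated_integral \<omega> t \<Phi> + compensated_integral \<omega> t \<Psi>"
proof -
  have add: "set_lebesgue_integral N S (\<lambda>(r, \<theta>). \<Phi> r \<theta> + \<Psi> r \<theta>)
      = set_lebesgue_integral N S (\<lambda>(r, \<theta>). \<Phi> r \<theta>) + set_lebesgue_integral N S (\<lambda>(r, \<theta>). \<Psi> r \<theta>)"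
    if "set_integrable N S (\<lambda>(r, \<theta>). \<Phi> r \<theta>)" "set_integrable N S (\<lambda>(r, \<theta>). \<Psi> r \<theta>)" for N S
    using that unfolding case_prod_beta' by (rule set_integral_add(2))
  show ?thesis
    using assms unfolding compensated_integral_def compensated_integrable_def
    by (elim conjE) (simp only: add add_diff_add)
qed

text \<open>Values outside \<open>{0<..t}\<close> do not count, so integrands need not agree at time
  0, where no left limit is available.\<close>

lemma compensated_integrable_cong:
  assumes "\<And>r \<theta>. r \<in> {0<..t} \<Longrightarrow> \<Phi> r \<theta> = \<Psi> r \<theta>"
  shows "compensated_integrable \<omega> t \<Phi> = compensated_integrable \<omega> t \<Psi>"
  unfolding compensated_integrable_def using assms
  by (intro arg_cong2[where f="(\<and>)"] set_integrable_cong) auto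

lemma compensated_integral_cong:
  assumes "\<And>r \<theta>. r \<in> {0<..t} \<Longrightarrow> \<Phi> r \<theta> = \<Psi> r \<theta>"
  shows "compensated_integral \<omega> t \<Phi> = compensated_integral \<omega> t \<Psi>"
proof -
  have "indicator ({0<..t} \<times> UNIV) p *\<^sub>R (case p of (r, \<theta>) \<Rightarrow> \<Phi> r \<theta>)
      = indicator ({0<..t} \<times> UNIV) p *\<^sub>R (case p of (r, \<theta>) \<Rightarrow> \<Psi> r \<theta>)" for p
    using assms by (auto simp: indicator_def split: prod.split)
  then show ?thesis
    unfolding compensated_integral_def set_lebesgue_integral_def by (simp only:)
qed

text \<open>Solutions carry integrability up to T, while their equation is read at every t in
  \<open>{0..T}\<close>.\<close>

lemma compensated_integrable_mono:
  assumes "compensated_integrable \<omega> T \<Phi>" "t \<le> T"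
  shows "compensated_integrable \<omega> t \<Phi>"
proof -
  have sub: "{0<..t} \<times> UNIV \<subseteq> ({0<..T} \<times> UNIV :: (real \<times> 'e) set)"
    using assms(2) by auto
  have m: "({0<..t} \<times> UNIV :: (real \<times> 'e) set) \<in> sets (borel \<Otimes>\<^sub>M borel)"
    by (intro pair_measureI) auto
  have "sets (jump_measure \<omega>) = sets (borel \<Otimes>\<^sub>M borel)"
    by (simp add: jump_measure_def)
  \<comment> \<open>\<open>measure_of\<close> keeps a given sigma-algebra whatever the set function
    is, so countable additivity of the formula is not at issue here.\<close>
  moreover have "sets (compensator \<omega>) = sets (borel \<Otimes>\<^sub>M borel)"
    using sets.sets_measure_of_eq[of "borel \<Otimes>\<^sub>M borel :: (real \<times> 'e) measure"]
    unfolding compensator_def by (simp add: space_pair_measure)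
  ultimately show ?thesis
    using assms(1) m sub unfolding compensated_integrable_def
    by (auto intro: set_integrable_subset)
qed

section \<open>Terminal values and their norm\<close>

lemma L2_terminal_zero: "(\<lambda>_. 0) \<in> L2_terminal T"
  by (simp add: L2_terminal_def)

text \<open>Stands in for the triangle inequality: with a common bound \<epsilon>, the crude bound
  \<open>2 * \<epsilon>\<^sup>2 + 2 * \<epsilon>\<^sup>2\<close> equals
  \<open>(2 * \<epsilon>)\<^sup>2\<close>, so nothing is lost. Finite second moments matter because
  \<open>L2_norm\<close> is 0 by default when the square is not integrable.\<close>

lemma L2_norm_add_le:
  fixes f g :: "_ \<Rightarrow> 'b::euclidean_space"
  assumes [measurable]: "f \<in> borel_measurable M" "g \<in> borel_measurable M"
    and f: "(\<integral>\<^sup>+\<omega>. ennreal ((norm (f \<omega>))\<^sup>2) \<partial>M) < \<infinity>"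
    and g: "(\<integral>\<^sup>+\<omega>. ennreal ((norm (g \<omega>))\<^sup>2) \<partial>M) < \<infinity>"
    and le: "L2_norm f \<le> \<epsilon>" "L2_norm g \<le> \<epsilon>"
  shows "L2_norm (\<lambda>\<omega>. f \<omega> + g \<omega>) \<le> 2 * \<epsilon>"
proof -
  have int: "integrable M (\<lambda>\<omega>. (norm (f \<omega>))\<^sup>2)" "integrable M (\<lambda>\<omega>. (norm (g \<omega>))\<^sup>2)"
    using f g by (auto intro!: integrableI_bounded)
  have "(\<integral>\<omega>. (norm (f \<omega> + g \<omega>))\<^sup>2 \<partial>M) \<le> (\<integral>\<omega>. 2 * (norm (f \<omega>))\<^sup>2 + 2 * (norm (g \<omega>))\<^sup>2 \<partial>M)"
    using int by (intro integral_mono' norm_add_power2_le) auto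
  also have "\<dots> = 2 * (L2_norm f)\<^sup>2 + 2 * (L2_norm g)\<^sup>2"
    using int by (simp add: L2_norm_def)
  also have "\<dots> \<le> 2 * \<epsilon>\<^sup>2 + 2 * \<epsilon>\<^sup>2"
    using le by (intro add_mono mult_left_mono power_mono) (auto simp: L2_norm_def)
  also have "\<dots> = (2 * \<epsilon>)\<^sup>2"
    by (simp add: power2_eq_square)
  finally have "L2_norm (\<lambda>\<omega>. f \<omega> + g \<omega>) \<le> sqrt ((2 * \<epsilon>)\<^sup>2)"
    unfolding L2_norm_def by (rule real_sqrt_le_mono)
  \<comment> \<open>The sign makes the square root of \<open>(2 * \<epsilon>)\<^sup>2\<close> equal
    to \<open>2 * \<epsilon>\<close>.\<close>
  moreover have "0 \<le> \<epsilon>"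
    by (rule order_trans[OF _ le(1)]) (simp add: L2_norm_def)
  ultimately show ?thesis
    by (simp add: real_sqrt_mult)
qed

end

section \<open>Superposition of controlled trajectories\<close>

context controlled_system
begin

text \<open>On almost every path both equations hold and their drift and jump terms are ordinary
  integrals, linear in state and control. Left limits are additive because both paths are
  cadlag.\<close>

lemma solution_add:
  assumes X: "solution x u X" and Y: "solution y v Y"
  shows "solution (x + y) (\<lambda>t \<omega>. u t \<omega> + v t \<omega>) (\<lambda>t \<omega>. X t \<omega> + Y t \<omega>)"
proof -
  have XL: "X \<in> L2_cadlag T" and YL: "Y \<in> L2_cadlag T"
    using X Y by (auto simp: solution_def)
  have "AE \<omega> in M. cadlag_on T (\<lambda>t. X t \<omega>)" "AE \<omega> in M. cadlag_on T (\<lambda>t. Y t \<omega>)"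
    using XL YL by (auto simp: L2_cadlag_def)
  moreover note X[unfolded solution_def, THEN conjunct2] Y[unfolded solution_def, THEN conjunct2]
  ultimately have "AE \<omega> in M.
        set_integrable lborel {0..T} (\<lambda>r. A r \<omega> *v (X r \<omega> + Y r \<omega>) + B r \<omega> *v (u r \<omega> + v r \<omega>)) \<and>
        compensated_integrable \<omega> T (\<lambda>r \<theta>. C r \<omega> \<theta> *v Lim (at_left r) (\<lambda>s. X s \<omega> + Y s \<omega>)) \<and>
        (\<forall>t\<in>{0..T}. X t \<omega> + Y t \<omega> =
           x + y + (LINT r:{0..t}|lborel. A r \<omega> *v (X r \<omega> + Y r \<omega>) + B r \<omega> *v (u r \<omega> + v r \<omega>))
             + compensated_integral \<omega> t (\<lambda>r \<theta>. C r \<omega> \<theta> *v Lim (at_left r) (\<lambda>s. X s \<omega> + Y s \<omega>)))"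
  \<comment> \<open>On one fixed path, facts 1 and 2 are the cadlag properties of X and Y, facts 3
    and 4 their integral equations.\<close>
  proof eventually_elim
    case (elim \<omega>)
    define a where "a = (\<lambda>r. A r \<omega> *v X r \<omega> + B r \<omega> *v u r \<omega>)"
    define b where "b = (\<lambda>r. A r \<omega> *v Y r \<omega> + B r \<omega> *v v r \<omega>)"
    define \<Phi> where "\<Phi> = (\<lambda>r \<theta>. C r \<omega> \<theta> *v Lim (at_left r) (\<lambda>s. X s \<omega>))"
    define \<Psi> where "\<Psi> = (\<lambda>r \<theta>. C r \<omega> \<theta> *v Lim (at_left r) (\<lambda>s. Y s \<omega>))"
    have drift: "A r \<omega> *v (X r \<omega> + Y r \<omega>) + B r \<omega> *v (u r \<omega> + v r \<omega>) = a r + b r" for r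
      by (simp add: a_def b_def matrix_vector_right_distrib)
    \<comment> \<open>At \<open>r = 0\<close> no left limit is known, so the splitting is claimed on
      (0, T] only; the jump integrals see no other times.\<close>
    have jump: "C r \<omega> \<theta> *v Lim (at_left r) (\<lambda>s. X s \<omega> + Y s \<omega>) = \<Phi> r \<theta> + \<Psi> r \<theta>"
      if "r \<in> {0<..T}" for r \<theta>
      using Lim_at_left_add[OF elim(1,2) that]
      by (simp add: \<Phi>_def \<Psi>_def matrix_vector_right_distrib)
    have ab: "set_integrable lborel {0..t} a" "set_integrable lborel {0..t} b" if "t \<le> T" for t
      using elim(3,4) that
      by (auto simp: a_def b_def intro: set_integrable_subset[where A="{0..T}"])
    have PP: "compensated_integrable \<omega> t \<Phi>" "compensated_integrable \<omega> t \<Psi>" if "t \<le> T" for t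
      using elim(3,4) that
      by (auto simp: \<Phi>_def \<Psi>_def intro: compensated_integrable_mono)
    have "X t \<omega> + Y t \<omega> = x + y + (LINT r:{0..t}|lborel. a r + b r)
        + compensated_integral \<omega> t (\<lambda>r \<theta>. C r \<omega> \<theta> *v Lim (at_left r) (\<lambda>s. X s \<omega> + Y s \<omega>))"
      if t: "t \<in> {0..T}" for t
    proof -
      have "compensated_integral \<omega> t (\<lambda>r \<theta>. C r \<omega> \<theta> *v Lim (at_left r) (\<lambda>s. X s \<omega> + Y s \<omega>))
          = compensated_integral \<omega> t (\<lambda>r \<theta>. \<Phi> r \<theta> + \<Psi> r \<theta>)"
        using t by (intro compensated_integral_cong jump) auto
      also have "\<dots> = compensated_integral \<omega> t \<Phi> + compensated_integral \<omega> t \<Psi>"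
        using t by (intro compensated_integral_add PP) auto
      moreover have "X t \<omega> = x + (LINT r:{0..t}|lborel. a r) + compensated_integral \<omega> t \<Phi>"
        using elim(3) t by (simp add: a_def \<Phi>_def)
      moreover have "Y t \<omega> = y + (LINT r:{0..t}|lborel. b r) + compensated_integral \<omega> t \<Psi>"
        using elim(4) t by (simp add: b_def \<Psi>_def)
      moreover have "(LINT r:{0..t}|lborel. a r + b r)
          = (LINT r:{0..t}|lborel. a r) + (LINT r:{0..t}|lborel. b r)"
        using t by (intro set_integral_add ab) auto
      ultimately show ?thesis
        by simp
    qed
    moreover have "compensated_integrable \<omega> T
        (\<lambda>r \<theta>. C r \<omega> \<theta> *v Lim (at_left r) (\<lambda>s. X s \<omega> + Y s \<omega>))"
      using compensated_integrable_add[OF PP] compensated_integrable_cong[OF jump] by simp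
    moreover have "set_integrable lborel {0..T} (\<lambda>r. a r + b r)"
      using ab by (intro set_integral_add) auto
    ultimately show ?case
      by (simp add: drift)
  qed
  then show ?thesis
    unfolding solution_def using L2_cadlag_add[OF T_pos XL YL] by simp
qed

text \<open>The path supremum controls the terminal value; these are the facts that
  \<open>L2_norm_add_le\<close> asks for.\<close>

lemma solution_terminal_square_integrable:
  assumes "solution x u X"
  shows "X T \<in> borel_measurable M" "(\<integral>\<^sup>+\<omega>. ennreal ((norm (X T \<omega>))\<^sup>2) \<partial>M) < \<infinity>"
proof -
  have X: "X \<in> L2_cadlag T"
    using assms unfolding solution_def by (rule conjunct1)
  have T: "T \<in> {0..T}"
    using T_pos by simp
  show "X T \<in> borel_measurable M"
    by (rule L2_cadlag_borel_measurable[OF X T])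
  show "(\<integral>\<^sup>+\<omega>. ennreal ((norm (X T \<omega>))\<^sup>2) \<partial>M) < \<infinity>"
    by (rule L2_cadlag_square_integrable[OF X T])
qed

section \<open>Steering in two pieces, and the equivalence\<close>

lemma approx_controllable_from_to_if_terminal_null:
  assumes \<xi>: "\<xi> \<in> L2_terminal T"
    and terminal: "approx_terminal_controllable_to \<xi>"
    and null: "approx_null_controllable"
  shows "approx_controllable_from_to x \<xi>"
  unfolding approx_controllable_from_to_def
proof (intro allI impI)
  fix \<epsilon> :: real assume "0 < \<epsilon>"
  \<comment> \<open>Each of the two errors gets half of \<epsilon>, matching the factor 2 in
    \<open>L2_norm_add_le\<close>.\<close>
  then have half: "0 < \<epsilon> / 2" by simp
  obtain y u X where u: "u \<in> admissible" and X: "solution y u X"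
    and Xle: "L2_norm (\<lambda>\<omega>. X T \<omega> - \<xi> \<omega>) \<le> \<epsilon> / 2"
    using terminal half unfolding approx_terminal_controllable_to_def by blast
  \<comment> \<open>Starting from \<open>x - y\<close> makes the two initial states add up to x. As
    y depends on \<epsilon>, null controllability is called on at a state not fixed
    beforehand.\<close>
  obtain v Y where v: "v \<in> admissible" and Y: "solution (x - y) v Y"
    and Yle: "L2_norm (\<lambda>\<omega>. Y T \<omega> - 0) \<le> \<epsilon> / 2"
    using null half unfolding approx_null_controllable_def approx_controllable_from_to_def by blast
  have \<xi>_meas [measurable]: "\<xi> \<in> borel_measurable M"
    using \<xi> borel_measurable_filt by (auto simp: L2_terminal_def)
  have [measurable]: "X T \<in> borel_measurable M" "Y T \<in> borel_measurable M"
    using X Y solution_terminal_square_integrable(1) by blast+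
  \<comment> \<open>The difference is written as a sum with \<open>- \<xi>\<close> to fit the lemma
    on sums.\<close>
  have "(\<integral>\<^sup>+\<omega>. ennreal ((norm (X T \<omega> + - \<xi> \<omega>))\<^sup>2) \<partial>M) < \<infinity>"
    using \<xi> solution_terminal_square_integrable(2)[OF X]
    by (intro nn_integral_norm_add_power2_finite) (auto simp: L2_terminal_def)
  then have "L2_norm (\<lambda>\<omega>. (X T \<omega> - \<xi> \<omega>) + Y T \<omega>) \<le> 2 * (\<epsilon> / 2)"
    using solution_terminal_square_integrable(2)[OF Y] Xle Yle
    by (intro L2_norm_add_le) auto
  then have "L2_norm (\<lambda>\<omega>. (X T \<omega> + Y T \<omega>) - \<xi> \<omega>) \<le> \<epsilon>"
    by (simp add: algebra_simps)
  moreover have "solution x (\<lambda>t \<omega>. u t \<omega> + v t \<omega>) (\<lambda>t \<omega>. X t \<omega> + Y t \<omega>)"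
    using solution_add[OF X Y] by simp
  moreover have "(\<lambda>t \<omega>. u t \<omega> + v t \<omega>) \<in> admissible"
    using u v T_pos by (simp add: admissible_def L2_predictable_add)
  ultimately show "\<exists>u\<in>admissible. \<exists>X. solution x u X \<and> L2_norm (\<lambda>\<omega>. X T \<omega> - \<xi> \<omega>) \<le> \<epsilon>"
    by blast
qed

end

theorem corollary3p3:
  fixes M :: "'w measure" and J :: nat
    and rate :: "'e::metric_space \<Rightarrow> real \<Rightarrow> real"
    and Q :: "'e \<Rightarrow> real \<Rightarrow> 'e measure"
    and \<tau> :: "nat \<Rightarrow> 'w \<Rightarrow> ereal" and \<gamma> :: "nat \<Rightarrow> 'w \<Rightarrow> 'e" and \<gamma>\<^sub>0 :: 'e
    and T :: real
    and A :: "real \<Rightarrow> 'w \<Rightarrow> real ^ 'n ^ 'n"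
    and B :: "real \<Rightarrow> 'w \<Rightarrow> real ^ 'd ^ 'n"
    and C :: "real \<Rightarrow> 'w \<Rightarrow> 'e \<Rightarrow> real ^ 'n ^ 'n"
  assumes "controlled_system M J rate Q \<tau> \<gamma> \<gamma>\<^sub>0 T A B C"
  shows "controlled_system.approx_controllable M J rate Q \<tau> \<gamma> T A B C \<longleftrightarrow>
     (\<forall>\<xi>\<in>mode_data.L2_terminal M J \<tau> \<gamma> T.
        controlled_system.approx_terminal_controllable_to M J rate Q \<tau> \<gamma> T A B C \<xi>) \<and>
     controlled_system.approx_null_controllable M J rate Q \<tau> \<gamma> T A B C"
proof -
  interpret controlled_system M J rate Q \<tau> \<gamma> \<gamma>\<^sub>0 T A B C
    by (rule assms)
  show ?thesis
  proof (intro iffI conjI ballI)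
    fix \<xi> :: "'w \<Rightarrow> real ^ 'n"
    assume "approx_controllable" "\<xi> \<in> L2_terminal T"
    then show "approx_terminal_controllable_to \<xi>"
      unfolding approx_controllable_def approx_controllable_from_to_def
        approx_terminal_controllable_to_def
      by blast
  next
    assume "approx_controllable"
    \<comment> \<open>The zero target is square-integrable, so this is the special case \<xi> =
      0.\<close>
    then show "approx_null_controllable"
      unfolding approx_controllable_def approx_null_controllable_def
      using L2_terminal_zero by blast
  next
    assume "(\<forall>\<xi>\<in>L2_terminal T. approx_terminal_controllable_to \<xi>) \<and> approx_null_controllable"
    then show "approx_controllable"
      unfolding approx_controllable_def
      using approx_controllable_from_to_if_terminal_null by blast
  qed
qed

end
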